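(* If $\Sigma_1$ and $\Sigma_2$ denote the antibalanced signed complete graph $K_m^-$ and the all-negative signed complete graph $-K_n$ respectively, then the HG-lexicographic product satisfies $\operatorname{bdim}(\Sigma_1[\Sigma_2])=\bar\nu(mn)$, where $\bar\nu(mn)$ is the balancing dimension of the antibalanced signed complete graph $K_{mn}^-$.
   Context: A signed graph $\Sigma=(G,\sigma)$ is a graph $G=(V,E)$ with a function $\sigma:E\to\{+1,-1\}$. The sign of a cycle is the product of the signs of its edges; $\Sigma$ is balanced if it has no cycle of sign $-1$, and antibalanced if $-\Sigma=(G,-\sigma)$ is balanced. Let $\Omega=\{-1,0,1\}$, with $\Omega^k\subset\mathbb{R}^k$ carrying the standard inner product $\langle\cdot,\cdot\rangle$. A vector valued switching function ($k$-switching function) for $\Sigma$ is a map $\zeta:V\to\Omega^k$ with $\langle\zeta(u),\zeta(v)\rangle\neq 0$ for every edge $uv\in E$; the switched signed graph $\Sigma^\zeta=(G,\sigma^\zeta)$ has $\sigma^\zeta(uv)=\sigma(uv)\operatorname{sgn}(\langle\zeta(u),\zeta(v)\rangle)$. The balancing dimension $\operatorname{bdim}(\Sigma)$ is the least integer $k\ge 1$ for which there is a $k$-switching function $\zeta:V\to\Omega^k$ such that $\Sigma^\zeta$ is all-positive (every edge has sign $+1$). $K_n^-$ denotes an antibalanced signed graph whose underlying graph is the complete graph $K_n$, and $\bar\nu(n)=\operatorname{bdim}(K_n^-)$ (independent of the choice of antibalanced signature, since all antibalanced signatures on $K_n$ are equivalent under ordinary $\{\pm1\}$-switching, which preserves $\operatorname{bdim}$).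 $-K_n$ is $K_n$ with every edge of sign $-1$. The lexicographic product $G_1[G_2]$ of graphs has vertex set $V(G_1)\times V(G_2)$, with $(u_i,v_j)$ adjacent to $(u_k,v_l)$ iff $u_i\sim u_k$ in $G_1$, or $u_i=u_k$ and $v_j\sim v_l$ in $G_2$. The HG-lexicographic product $\Sigma_1[\Sigma_2]$ of $\Sigma_1=(G_1,\sigma_1)$ and $\Sigma_2=(G_2,\sigma_2)$ is the signed graph on $G_1[G_2]$ with signature $\sigma((u_i,v_j)(u_k,v_l))=\sigma_1(u_iu_k)$ if $i\ne k$, and $=\sigma_2(v_jv_l)$ if $i=k$. *)

theory Defs
  imports Complex_Main "Jordan_Normal_Form.Matrix"
begin

record 'v sgraph =
  verts :: "'v set"
  adj :: "'v \<Rightarrow> 'v \<Rightarrow> bool"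
  sig :: "'v \<Rightarrow> 'v \<Rightarrow> real"

text \<open>The signature of an undirected edge is stored as a symmetric function of its two ends;
  values of \<^term>\<open>sig\<close> on non-adjacent pairs are irrelevant.\<close>

definition signed_graph :: "'v sgraph \<Rightarrow> bool" where
  "signed_graph S \<longleftrightarrow>
     finite (verts S) \<and>
     (\<forall>u v. adj S u v \<longrightarrow>
        u \<in> verts S \<and> v \<in> verts S \<and> u \<noteq> v \<and> adj S v u \<and>
        sig S u v \<in> {1, -1} \<and> sig S v u = sig S u v)"

text \<open>A cycle is the list of its vertices, without repetition of the first one at the end.\<close>

definition is_cycle :: "'v sgraph \<Rightarrow> 'v list \<Rightarrow> bool" where
  "is_cycle S c \<longleftrightarrow> length c \<ge> 3 \<and> distinct c \<and>
     (\<forall>i<length c. adj S (c ! i) (c ! (Suc i mod length c)))"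

definition cycle_sign :: "'v sgraph \<Rightarrow> 'v list \<Rightarrow> real" where
  "cycle_sign S c = (\<Prod>i<length c. sig S (c ! i) (c ! (Suc i mod length c)))"

definition balanced :: "'v sgraph \<Rightarrow> bool" where
  "balanced S \<longleftrightarrow> \<not> (\<exists>c. is_cycle S c \<and> cycle_sign S c = -1)"

definition negate :: "'v sgraph \<Rightarrow> 'v sgraph" where
  "negate S = S\<lparr>sig := (\<lambda>u v. - sig S u v)\<rparr>"

definition antibalanced :: "'v sgraph \<Rightarrow> bool" where
  "antibalanced S \<longleftrightarrow> balanced (negate S)"

definition all_positive :: "'v sgraph \<Rightarrow> bool" where
  "all_positive S \<longleftrightarrow> (\<forall>u v. adj S u v \<longrightarrow> sig S u v = 1)"

definition all_negative :: "'v sgraph \<Rightarrow> bool" where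
  "all_negative S \<longleftrightarrow> (\<forall>u v. adj S u v \<longrightarrow> sig S u v = -1)"

definition Omega :: "nat \<Rightarrow> real vec set" where
  "Omega k = {x \<in> carrier_vec k. \<forall>i<k. x $ i \<in> {-1, 0, 1}}"

definition switching_function :: "nat \<Rightarrow> 'v sgraph \<Rightarrow> ('v \<Rightarrow> real vec) \<Rightarrow> bool" where
  "switching_function k S \<zeta> \<longleftrightarrow>
     (\<forall>v \<in> verts S. \<zeta> v \<in> Omega k) \<and> (\<forall>u v. adj S u v \<longrightarrow> \<zeta> u \<bullet> \<zeta> v \<noteq> 0)"

definition switched :: "'v sgraph \<Rightarrow> ('v \<Rightarrow> real vec) \<Rightarrow> 'v sgraph" where
  "switched S \<zeta> = S\<lparr>sig := (\<lambda>u v. sig S u v * sgn (\<zeta> u \<bullet> \<zeta> v))\<rparr>"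

text \<open>The minimum is over a nonempty set for every signed graph: use one coordinate per edge
  \<open>u v\<close>, with entries \<open>1\<close> and \<open>sig S u v\<close> at its two ends and \<open>0\<close> elsewhere.\<close>

definition bdim :: "'v sgraph \<Rightarrow> nat" where
  "bdim S = (LEAST k. k \<ge> 1 \<and> (\<exists>\<zeta>. switching_function k S \<zeta> \<and> all_positive (switched S \<zeta>)))"

definition signed_complete :: "nat \<Rightarrow> 'v sgraph \<Rightarrow> bool" where
  "signed_complete n S \<longleftrightarrow>
     signed_graph S \<and> card (verts S) = n \<and>
     (\<forall>u \<in> verts S. \<forall>v \<in> verts S. u \<noteq> v \<longrightarrow> adj S u v)"

definition antibalanced_complete :: "nat \<Rightarrow> 'v sgraph \<Rightarrow> bool" where
  "antibalanced_complete n S \<longleftrightarrow> signed_complete n S \<and> antibalanced S"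

definition negative_complete :: "nat \<Rightarrow> 'v sgraph \<Rightarrow> bool" where
  "negative_complete n S \<longleftrightarrow> signed_complete n S \<and> all_negative S"

text \<open>The common balancing dimension of all antibalanced signed complete graphs on \<open>n\<close> vertices.
  Up to relabelling, the vertices may be taken to be natural numbers.\<close>

definition nu_bar :: "nat \<Rightarrow> nat" where
  "nu_bar n = (THE d. \<exists>S :: nat sgraph. antibalanced_complete n S \<and> bdim S = d)"

definition hg_lex :: "'a sgraph \<Rightarrow> 'b sgraph \<Rightarrow> ('a \<times> 'b) sgraph" where
  "hg_lex S T =
     \<lparr>verts = verts S \<times> verts T,
      adj = (\<lambda>(a, b) (c, d).
        a \<in> verts S \<and> c \<in> verts S \<and> b \<in> verts T \<and> d \<in> verts T \<and>
        (adj S a c \<or> a = c \<and> adj T b d)),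
      sig = (\<lambda>(a, b) (c, d). if a \<noteq> c then sig S a c else sig T b d)\<rparr>"

end

(* A balanced complete graph has signature s u * s v for some s with values 1 and -1, because all
   triangles through a fixed root are positive.  For signature - s u * s v, multiplying a switching
   function by s turns the condition that it makes the graph all-positive into the condition that
   the vectors have pairwise negative inner products, which depends on the number of vertices only.
   The product of K_m^- and -K_n is complete with signature - s' (a,b) * s' (c,d), where
   s' (a,b) = s a and s is taken from K_m^-; so it falls under the same condition as K_mn^-. *)

theory Submission
  imports Defs
begin

text \<open>No graph or signature enters here, so the notion can be moved between vertex sets of
  different types.\<close>

definition negative_system :: "nat \<Rightarrow> 'v set \<Rightarrow> ('v \<Rightarrow> real vec) \<Rightarrow> bool" where
  "negative_system k A \<xi> \<longleftrightarrow>
     (\<forall>v\<in>A. \<xi> v \<in> Omega k) \<and> (\<forall>u\<in>A. \<forall>v\<in>A. u \<noteq> v \<longrightarrow> \<xi> u \<bullet> \<xi> v < 0)"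

lemma negative_system_transfer:
  assumes "negative_system k A \<xi>" and "inj_on f B" and "f ` B \<subseteq> A"
  shows "negative_system k B (\<xi> \<circ> f)"
  using assms unfolding negative_system_def inj_on_def by (simp add: image_subset_iff) blast

text \<open>Systems are pulled back along a bijection and along its inverse. This lets graphs on
  pairs and graphs on natural numbers be compared through their vertex counts.\<close>

lemma ex_negative_system_cong_card:
  assumes "finite A" "finite B" "card A = card B"
  shows "(\<exists>\<xi>. negative_system k A \<xi>) \<longleftrightarrow> (\<exists>\<xi>. negative_system k B \<xi>)"
proof -
  obtain f where f: "bij_betw f A B"
    using assms finite_same_card_bij by blast
  have g: "bij_betw (inv_into A f) B A"
    using f by (rule bij_betw_inv_into)
  show ?thesis
    using negative_system_transfer[of k A _ "inv_into A f" B]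
      negative_system_transfer[of k B _ f A] f g
    unfolding bij_betw_def by (metis order_refl)
qed

lemma Omega_smult:
  assumes "x \<in> Omega k" and "c \<in> {1, -1::real}"
  shows "c \<cdot>\<^sub>v x \<in> Omega k"
  using assms unfolding Omega_def by auto

lemma scalar_prod_smult_smult:
  fixes x y :: "real vec"
  assumes "x \<in> carrier_vec k" and "y \<in> carrier_vec k"
  shows "(c \<cdot>\<^sub>v x) \<bullet> (d \<cdot>\<^sub>v y) = c * d * (x \<bullet> y)"
  using assms by simp

lemma signed_complete_adj:
  assumes "signed_complete n S"
  shows "adj S u v \<longleftrightarrow> u \<in> verts S \<and> v \<in> verts S \<and> u \<noteq> v"
  using assms unfolding signed_complete_def signed_graph_def by blast

lemma signed_complete_iff:
  "signed_complete n S \<longleftrightarrow>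
     finite (verts S) \<and> card (verts S) = n \<and>
     (\<forall>u v. adj S u v \<longleftrightarrow> u \<in> verts S \<and> v \<in> verts S \<and> u \<noteq> v) \<and>
     (\<forall>u\<in>verts S. \<forall>v\<in>verts S. u \<noteq> v \<longrightarrow> sig S u v \<in> {1, -1} \<and> sig S v u = sig S u v)"
  unfolding signed_complete_def signed_graph_def by (rule iffI) blast+

text \<open>The demand for nonzero inner products on edges is absorbed: as \<open>sgn 0 = 0\<close>,
  a vanishing inner product would make the switched sign 0 instead of 1.\<close>

lemma switching_all_positive_iff:
  "switching_function k S \<zeta> \<and> all_positive (switched S \<zeta>) \<longleftrightarrow>
     (\<forall>v\<in>verts S. \<zeta> v \<in> Omega k) \<and> (\<forall>u v. adj S u v \<longrightarrow> sig S u v * sgn (\<zeta> u \<bullet> \<zeta> v) = 1)"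
  unfolding switching_function_def all_positive_def switched_def by (auto simp: sgn_if)

text \<open>Both directions use the same map, scaling the vector at \<open>v\<close> by
  \<open>s v\<close>; it is its own inverse because \<open>s v\<close> squares to 1, and it stays
  inside \<open>Omega k\<close>.\<close>

lemma ex_switching_iff_negative_system:
  fixes s :: "'v \<Rightarrow> real"
  assumes S: "signed_complete n S"
    and s: "\<And>v. v \<in> verts S \<Longrightarrow> s v \<in> {1, -1}"
    and sig: "\<And>u v. adj S u v \<Longrightarrow> sig S u v = - (s u * s v)"
  shows "(\<exists>\<zeta>. switching_function k S \<zeta> \<and> all_positive (switched S \<zeta>)) \<longleftrightarrow>
         (\<exists>\<xi>. negative_system k (verts S) \<xi>)"
proof
  have scaled: "(s u \<cdot>\<^sub>v \<zeta> u) \<bullet> (s v \<cdot>\<^sub>v \<zeta> v) = s u * s v * (\<zeta> u \<bullet> \<zeta> v)"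
    if "\<forall>v\<in>verts S. \<zeta> v \<in> Omega k" "u \<in> verts S" "v \<in> verts S" for \<zeta> u v
    using that by (intro scalar_prod_smult_smult[of _ k]) (auto simp: Omega_def)
  have Om: "s v \<cdot>\<^sub>v \<zeta> v \<in> Omega k"
    if "\<forall>v\<in>verts S. \<zeta> v \<in> Omega k" "v \<in> verts S" for \<zeta> v
    using that s by (simp add: Omega_smult)
  {
    assume "\<exists>\<zeta>. switching_function k S \<zeta> \<and> all_positive (switched S \<zeta>)"
    then obtain \<zeta> where \<zeta>: "\<forall>v\<in>verts S. \<zeta> v \<in> Omega k"
      and pos: "\<And>u v. adj S u v \<Longrightarrow> sig S u v * sgn (\<zeta> u \<bullet> \<zeta> v) = 1"
      unfolding switching_all_positive_iff by blast
    have "s u * s v * (\<zeta> u \<bullet> \<zeta> v) < 0" if uv: "u \<in> verts S" "v \<in> verts S" "u \<noteq> v" for u v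
    proof -
      have "adj S u v"
        using uv signed_complete_adj[OF S] by blast
      then have "- (s u * s v) * sgn (\<zeta> u \<bullet> \<zeta> v) = 1"
        using pos sig by metis
      then show ?thesis
        using s[OF uv(1)] s[OF uv(2)] by (auto simp: sgn_if split: if_splits)
    qed
    then have "negative_system k (verts S) (\<lambda>v. s v \<cdot>\<^sub>v \<zeta> v)"
      unfolding negative_system_def using \<zeta> by (simp add: Om scaled)
    then show "\<exists>\<xi>. negative_system k (verts S) \<xi>"
      by blast
  }
  {
    assume "\<exists>\<xi>. negative_system k (verts S) \<xi>"
    then obtain \<xi> where \<xi>: "\<forall>v\<in>verts S. \<xi> v \<in> Omega k"
      and neg: "\<And>u v. u \<in> verts S \<Longrightarrow> v \<in> verts S \<Longrightarrow> u \<noteq> v \<Longrightarrow> \<xi> u \<bullet> \<xi> v < 0"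
      unfolding negative_system_def by blast
    have "sig S u v * sgn ((s u \<cdot>\<^sub>v \<xi> u) \<bullet> (s v \<cdot>\<^sub>v \<xi> v)) = 1" if "adj S u v" for u v
    proof -
      have uv: "u \<in> verts S" "v \<in> verts S" "u \<noteq> v"
        using that signed_complete_adj[OF S] by blast+
      show ?thesis
        \<comment> \<open>The factor \<open>s u * s v\<close> now occurs twice, once from the
          signature and once from the scaling, and cancels as a square.\<close>
        unfolding sig[OF that] scaled[OF \<xi> uv(1,2)]
        using neg[OF uv] s[OF uv(1)] s[OF uv(2)] by (auto simp: sgn_mult)
    qed
    then show "\<exists>\<zeta>. switching_function k S \<zeta> \<and> all_positive (switched S \<zeta>)"
      unfolding switching_all_positive_iff using \<xi>
      by (intro exI[of _ "\<lambda>v. s v \<cdot>\<^sub>v \<xi> v"]) (simp add: Om)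
  }
qed

text \<open>The right-hand side mentions neither \<open>S\<close> nor \<open>s\<close>, so any two
  graphs that satisfy the hypotheses for the same \<open>n\<close> have equal balancing
  dimension.\<close>

lemma bdim_signed_complete:
  fixes s :: "'v \<Rightarrow> real"
  assumes S: "signed_complete n S"
    and s: "\<And>v. v \<in> verts S \<Longrightarrow> s v \<in> {1, -1}"
    and sig: "\<And>u v. adj S u v \<Longrightarrow> sig S u v = - (s u * s v)"
  shows "bdim S = (LEAST k. k \<ge> 1 \<and> (\<exists>\<xi>. negative_system k {..<n} \<xi>))"
proof -
  have "finite (verts S)" "card (verts S) = card {..<n}"
    using S unfolding signed_complete_def signed_graph_def by auto
  then have "(\<exists>\<zeta>. switching_function k S \<zeta> \<and> all_positive (switched S \<zeta>)) \<longleftrightarrow>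
      (\<exists>\<xi>. negative_system k {..<n} \<xi>)" for k
    using ex_switching_iff_negative_system[of n S s k] assms
      ex_negative_system_cong_card[of "verts S" "{..<n}" k] by blast
  then show ?thesis
    unfolding bdim_def by (simp only:)
qed

text \<open>A product of three signs is 1 or -1, and balance excludes -1.\<close>

lemma balanced_triangle:
  assumes S: "signed_complete n S" and "balanced S"
    and uvw: "u \<in> verts S" "v \<in> verts S" "w \<in> verts S" "distinct [u, v, w]"
  shows "sig S u v * sig S v w * sig S w u = 1"
proof -
  have a: "adj S u v" "adj S v w" "adj S w u"
    using uvw signed_complete_adj[OF S] by auto
  have "is_cycle S [u, v, w]"
    unfolding is_cycle_def using uvw(4) a by (simp add: All_less_Suc)
  then have "cycle_sign S [u, v, w] \<noteq> -1"
    using \<open>balanced S\<close> unfolding balanced_def by blast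
  moreover have "cycle_sign S [u, v, w] = sig S u v * sig S v w * sig S w u"
    unfolding cycle_sign_def by (simp add: lessThan_Suc)
  moreover have "sig S u v \<in> {1,-1}" "sig S v w \<in> {1,-1}" "sig S w u \<in> {1,-1}"
    using S a unfolding signed_complete_def signed_graph_def by blast+
  ultimately show ?thesis
    by auto
qed

lemma balanced_complete_potential:
  assumes S: "signed_complete n S" and bal: "balanced S"
  obtains s :: "'v \<Rightarrow> real" where "\<And>v. v \<in> verts S \<Longrightarrow> s v \<in> {1, -1}"
    and "\<And>u v. adj S u v \<Longrightarrow> sig S u v = s u * s v"
proof (cases "verts S = {}")
  case True
  then show ?thesis
    using that[of "\<lambda>_. 1"] signed_complete_adj[OF S] by auto
next
  case False
  then obtain r where r: "r \<in> verts S" by blast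
  have edge: "sig S u v \<in> {1, -1} \<and> sig S v u = sig S u v" if "adj S u v" for u v
    using S that unfolding signed_complete_def signed_graph_def by blast
  \<comment> \<open>The root gets the value 1 by hand, since \<open>sig S r r\<close> belongs to no
    edge and may be any real number.\<close>
  define s where "s v = (if v = r then 1 else sig S r v)" for v
  show ?thesis
  proof (rule that[of s])
    show s: "s v \<in> {1, -1}" if "v \<in> verts S" for v
      using that r edge signed_complete_adj[OF S] unfolding s_def by auto
    show "sig S u v = s u * s v" if uv: "adj S u v" for u v
    proof (cases "u = r \<or> v = r")
      case True
      then show ?thesis
        using uv edge[OF uv] signed_complete_adj[OF S] unfolding s_def by auto
    next
      case False
      have V: "u \<in> verts S" "v \<in> verts S" "u \<noteq> v"
        using uv signed_complete_adj[OF S] by auto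
      have "adj S r v"
        using V r False signed_complete_adj[OF S] by auto
      \<comment> \<open>The triangle is \<open>r\<close>, \<open>u\<close>, \<open>v\<close>; its
        closing factor \<open>sig S v r\<close> equals \<open>s v\<close> by symmetry of the
        signature. Each sign is its own inverse, so the equation can be solved for
        \<open>sig S u v\<close>.\<close>
      then have "s u * sig S u v * s v = 1"
        using balanced_triangle[OF S bal r V(1,2)] V False edge unfolding s_def by auto
      then show ?thesis
        using s[OF V(1)] s[OF V(2)] by auto
    qed
  qed
qed

lemma antibalanced_complete_potential:
  assumes "antibalanced_complete n S"
  obtains s :: "'v \<Rightarrow> real" where "\<And>v. v \<in> verts S \<Longrightarrow> s v \<in> {1, -1}"
    and "\<And>u v. adj S u v \<Longrightarrow> sig S u v = - (s u * s v)"
proof -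
  have "signed_complete n S" and "balanced (negate S)"
    using assms unfolding antibalanced_complete_def antibalanced_def by auto
  moreover from this(1) have "signed_complete n (negate S)"
    unfolding signed_complete_iff negate_def by auto
  ultimately obtain s :: "'v \<Rightarrow> real" where "\<And>v. v \<in> verts (negate S) \<Longrightarrow> s v \<in> {1, -1}"
    and "\<And>u v. adj (negate S) u v \<Longrightarrow> sig (negate S) u v = s u * s v"
    using balanced_complete_potential by blast
  then show ?thesis
    using that[of s] unfolding negate_def by fastforce
qed

lemma bdim_antibalanced_complete:
  assumes "antibalanced_complete n S"
  shows "bdim S = (LEAST k. k \<ge> 1 \<and> (\<exists>\<xi>. negative_system k {..<n} \<xi>))"
proof -
  obtain s where "\<And>v. v \<in> verts S \<Longrightarrow> s v \<in> {1, -1::real}"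
    and "\<And>u v. adj S u v \<Longrightarrow> sig S u v = - (s u * s v)"
    using antibalanced_complete_potential[OF assms] by blast
  then show ?thesis
    using assms bdim_signed_complete unfolding antibalanced_complete_def by blast
qed

text \<open>After negation every factor of a cycle sign is 1.\<close>

lemma all_negative_imp_antibalanced:
  assumes "all_negative S"
  shows "antibalanced S"
proof -
  have "cycle_sign (negate S) c = 1" if "is_cycle (negate S) c" for c
    using assms that unfolding cycle_sign_def is_cycle_def all_negative_def negate_def
    by (intro prod.neutral) simp
  then show ?thesis
    unfolding antibalanced_def balanced_def by force
qed

lemma ex_antibalanced_complete_nat: "\<exists>S :: nat sgraph. antibalanced_complete n S"
proof
  let ?S = "\<lparr>verts = {..<n}, adj = (\<lambda>u v. u < n \<and> v < n \<and> u \<noteq> v), sig = (\<lambda>_ _. -1)\<rparr>"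
  have "signed_complete n ?S"
    unfolding signed_complete_def signed_graph_def by auto
  moreover have "antibalanced ?S"
    by (rule all_negative_imp_antibalanced) (simp add: all_negative_def)
  ultimately show "antibalanced_complete n ?S"
    unfolding antibalanced_complete_def by blast
qed

text \<open>This resolves the \<open>THE\<close> in \<open>nu_bar\<close>: the all-negative graph on
  \<open>{..<n}\<close> gives existence, and the common formula for \<open>bdim\<close> gives
  uniqueness.\<close>

lemma nu_bar_eq: "nu_bar n = (LEAST k. k \<ge> 1 \<and> (\<exists>\<xi>. negative_system k {..<n} \<xi>))"
  unfolding nu_bar_def
  using bdim_antibalanced_complete ex_antibalanced_complete_nat by (intro the_equality) blast+

text \<open>Distinct pairs either differ in the first coordinate and are joined through
  \<open>S\<close>, or agree there, differ in the second and are joined through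
  \<open>T\<close>.\<close>

lemma signed_complete_hg_lex:
  assumes S: "signed_complete m S" and T: "signed_complete n T"
  shows "signed_complete (m * n) (hg_lex S T)"
proof -
  have "sig S a c \<in> {1, -1} \<and> sig S c a = sig S a c"
    if "a \<in> verts S" "c \<in> verts S" "a \<noteq> c" for a c
    using S that unfolding signed_complete_iff by blast
  moreover have "sig T b d \<in> {1, -1} \<and> sig T d b = sig T b d"
    if "b \<in> verts T" "d \<in> verts T" "b \<noteq> d" for b d
    using T that unfolding signed_complete_iff by blast
  moreover have "finite (verts S \<times> verts T)" "card (verts S \<times> verts T) = m * n"
    using assms unfolding signed_complete_iff by (auto simp: card_cartesian_product)
  ultimately show ?thesis
    unfolding signed_complete_iff hg_lex_def
    by (simp add: signed_complete_adj[OF S] signed_complete_adj[OF T] split_beta prod_eq_iff) blast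
qed

theorem proposition2p17:
  fixes \<Sigma>1 :: "'a sgraph" and \<Sigma>2 :: "'b sgraph" and m n :: nat
  assumes "m \<ge> 1" and "n \<ge> 1"
    and "antibalanced_complete m \<Sigma>1"
    and "negative_complete n \<Sigma>2"
  shows "bdim (hg_lex \<Sigma>1 \<Sigma>2) = nu_bar (m * n)"
proof -
  obtain s where s: "\<And>v. v \<in> verts \<Sigma>1 \<Longrightarrow> s v \<in> {1, -1::real}"
    and sig: "\<And>u v. adj \<Sigma>1 u v \<Longrightarrow> sig \<Sigma>1 u v = - (s u * s v)"
    using antibalanced_complete_potential[OF assms(3)] by blast
  have S: "signed_complete m \<Sigma>1" and T: "signed_complete n \<Sigma>2" and "all_negative \<Sigma>2"
    using assms unfolding antibalanced_complete_def negative_complete_def by auto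
  have sq: "s a * s a = 1" if "a \<in> verts \<Sigma>1" for a
    using s[OF that] by auto
  \<comment> \<open>Between different copies of \<open>\<Sigma>2\<close> the sign comes from
    \<open>\<Sigma>1\<close>. Inside the copy at \<open>a\<close> it is -1, which equals
    \<open>- (s a * s a)\<close> by \<open>sq\<close>; this is where all-negativity of
    \<open>\<Sigma>2\<close> enters.\<close>
  have "sig (hg_lex \<Sigma>1 \<Sigma>2) x y = - (s (fst x) * s (fst y))" if "adj (hg_lex \<Sigma>1 \<Sigma>2) x y" for x y
    using that sig sq signed_complete_adj[OF S] \<open>all_negative \<Sigma>2\<close>
    unfolding hg_lex_def all_negative_def by (auto split: prod.splits)
  moreover have "s (fst x) \<in> {1, -1}" if "x \<in> verts (hg_lex \<Sigma>1 \<Sigma>2)" for x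
    using that s[of "fst x"] unfolding hg_lex_def by auto
  ultimately show ?thesis
    unfolding nu_bar_eq
    using bdim_signed_complete[OF signed_complete_hg_lex[OF S T], of "\<lambda>x. s (fst x)"] by blast
qed

end
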